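(* For every integer $m\ge 0$ the following identities hold in the algebra of dual quaternions: (i) $$jN_{m+3}^{(3)}-3JN_{m+3}^{(3)}=2jN_{m}^{(3)};$$ (ii) $$jN_{m+1}^{(3)}+jN_{m}^{(3)}=3JN_{m+2}^{(3)};$$ (iii) $$\left(jN_{m}^{(3)}\right)^{2}+3JN_{m+3}^{(3)}jN_{m+3}^{(3)}=4^{m+3}(1+4\mathbf{i}+8\mathbf{j}+16\mathbf{k}).$$
   Context: Dual quaternions: the real algebra of elements $a+b\mathbf{i}+c\mathbf{j}+d\mathbf{k}$ ($a,b,c,d\in\mathbb{R}$) with componentwise addition and bilinear multiplication determined by $1$ being the identity and $\mathbf{i}^2=\mathbf{j}^2=\mathbf{k}^2=0$, $\mathbf{ij}=\mathbf{ji}=\mathbf{jk}=\mathbf{kj}=\mathbf{ik}=\mathbf{ki}=0$ (all products of two units among $\mathbf{i},\mathbf{j},\mathbf{k}$ vanish). The third-order Jacobsthal numbers are defined by $J_0^{(3)}=0$, $J_1^{(3)}=J_2^{(3)}=1$, $J_{n+3}^{(3)}=J_{n+2}^{(3)}+J_{n+1}^{(3)}+2J_n^{(3)}$ for $n\ge 0$. The third-order Jacobsthal-Lucas numbers are defined by $j_0^{(3)}=2$, $j_1^{(3)}=1$, $j_2^{(3)}=5$, $j_{n+3}^{(3)}=j_{n+2}^{(3)}+j_{n+1}^{(3)}+2j_n^{(3)}$ for $n\ge 0$. The superscript $(3)$ is part of the notation, not an exponent. For $m\ge 0$, the dual third-order Jacobsthal quaternions are $JN_m^{(3)}=J_m^{(3)}+J_{m+1}^{(3)}\mathbf{i}+J_{m+2}^{(3)}\mathbf{j}+J_{m+3}^{(3)}\mathbf{k}$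 and the dual third-order Jacobsthal-Lucas quaternions are $jN_m^{(3)}=j_m^{(3)}+j_{m+1}^{(3)}\mathbf{i}+j_{m+2}^{(3)}\mathbf{j}+j_{m+3}^{(3)}\mathbf{k}$. *)

theory Defs
  imports Complex_Main
begin

datatype dquat = DQuat (dq_re: real) (dq_im1: real) (dq_im2: real) (dq_im3: real)

lemma dquat_eq_iff:
  "x = y \<longleftrightarrow> dq_re x = dq_re y \<and> dq_im1 x = dq_im1 y \<and> dq_im2 x = dq_im2 y \<and> dq_im3 x = dq_im3 y"
  by (cases x; cases y) simp

instantiation dquat :: comm_ring_1
begin

definition zero_dquat :: dquat where
  "0 = DQuat 0 0 0 0"

definition one_dquat :: dquat where
  "1 = DQuat 1 0 0 0"

definition plus_dquat :: "dquat \<Rightarrow> dquat \<Rightarrow> dquat" where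
  "x + y = DQuat (dq_re x + dq_re y) (dq_im1 x + dq_im1 y) (dq_im2 x + dq_im2 y) (dq_im3 x + dq_im3 y)"

definition uminus_dquat :: "dquat \<Rightarrow> dquat" where
  "- x = DQuat (- dq_re x) (- dq_im1 x) (- dq_im2 x) (- dq_im3 x)"

definition minus_dquat :: "dquat \<Rightarrow> dquat \<Rightarrow> dquat" where
  "x - y = DQuat (dq_re x - dq_re y) (dq_im1 x - dq_im1 y) (dq_im2 x - dq_im2 y) (dq_im3 x - dq_im3 y)"

(* Bilinear expansion with all products of two imaginary units equal to 0; the product
   table is confirmed by the lemma dq_unit_mult below. *)
definition times_dquat :: "dquat \<Rightarrow> dquat \<Rightarrow> dquat" where
  "x * y = DQuat (dq_re x * dq_re y)
     (dq_re x * dq_im1 y + dq_im1 x * dq_re y)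
     (dq_re x * dq_im2 y + dq_im2 x * dq_re y)
     (dq_re x * dq_im3 y + dq_im3 x * dq_re y)"

instance
  by standard
    (auto simp: dquat_eq_iff zero_dquat_def one_dquat_def plus_dquat_def uminus_dquat_def
      minus_dquat_def times_dquat_def algebra_simps)

end

instantiation dquat :: real_algebra_1
begin

definition scaleR_dquat :: "real \<Rightarrow> dquat \<Rightarrow> dquat" where
  "r *\<^sub>R x = DQuat (r * dq_re x) (r * dq_im1 x) (r * dq_im2 x) (r * dq_im3 x)"

instance
  by standard
    (auto simp: dquat_eq_iff scaleR_dquat_def plus_dquat_def times_dquat_def algebra_simps)

end

definition dq_i :: dquat where "dq_i = DQuat 0 1 0 0"
definition dq_j :: dquat where "dq_j = DQuat 0 0 1 0"
definition dq_k :: dquat where "dq_k = DQuat 0 0 0 1"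

lemma dquat_expansion:
  "DQuat a b c d = of_real a + b *\<^sub>R dq_i + c *\<^sub>R dq_j + d *\<^sub>R dq_k"
  by (simp add: of_real_def scaleR_dquat_def plus_dquat_def one_dquat_def dq_i_def dq_j_def dq_k_def)

lemma dq_unit_mult:
  "dq_i * dq_i = 0" "dq_j * dq_j = 0" "dq_k * dq_k = 0"
  "dq_i * dq_j = 0" "dq_j * dq_i = 0" "dq_j * dq_k = 0"
  "dq_k * dq_j = 0" "dq_i * dq_k = 0" "dq_k * dq_i = 0"
  by (simp_all add: times_dquat_def zero_dquat_def dq_i_def dq_j_def dq_k_def)

fun jacobsthal3 :: "nat \<Rightarrow> nat" where
  "jacobsthal3 0 = 0"
| "jacobsthal3 (Suc 0) = 1"
| "jacobsthal3 (Suc (Suc 0)) = 1"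
| "jacobsthal3 (Suc (Suc (Suc n))) =
     jacobsthal3 (Suc (Suc n)) + jacobsthal3 (Suc n) + 2 * jacobsthal3 n"

fun jacobsthal_lucas3 :: "nat \<Rightarrow> nat" where
  "jacobsthal_lucas3 0 = 2"
| "jacobsthal_lucas3 (Suc 0) = 1"
| "jacobsthal_lucas3 (Suc (Suc 0)) = 5"
| "jacobsthal_lucas3 (Suc (Suc (Suc n))) =
     jacobsthal_lucas3 (Suc (Suc n)) + jacobsthal_lucas3 (Suc n) + 2 * jacobsthal_lucas3 n"

definition JN3 :: "nat \<Rightarrow> dquat" where
  "JN3 m = of_real (real (jacobsthal3 m)) + real (jacobsthal3 (m + 1)) *\<^sub>R dq_i
     + real (jacobsthal3 (m + 2)) *\<^sub>R dq_j + real (jacobsthal3 (m + 3)) *\<^sub>R dq_k"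

definition jN3 :: "nat \<Rightarrow> dquat" where
  "jN3 m = of_real (real (jacobsthal_lucas3 m)) + real (jacobsthal_lucas3 (m + 1)) *\<^sub>R dq_i
     + real (jacobsthal_lucas3 (m + 2)) *\<^sub>R dq_j + real (jacobsthal_lucas3 (m + 3)) *\<^sub>R dq_k"

end

theory Submission
  imports Defs
begin

text \<open>
  The quaternion identities (i) and (ii) hold componentwise, by the common recurrence. For (iii),
  the characteristic polynomial is \<open>x\<^sup>3 - x\<^sup>2 - x - 2 = (x - 2) (x\<^sup>2 + x + 1)\<close>, so taking differences
  with step 3 removes the 3-periodic part of the Lucas numbers and leaves a pure power of 2.
  Substituting (i), the left-hand side of (iii) becomes the square of such a difference.
\<close>

text \<open>Both sides obey the same third-order recurrence, since \<open>2\<close> is a root of its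
  characteristic polynomial; only three initial values remain to be compared.\<close>

lemma jacobsthal_lucas3_add_3:
  "jacobsthal_lucas3 (n + 3) = jacobsthal_lucas3 n + 2 ^ (n + 3)"
  by (induction n rule: jacobsthal_lucas3.induct) (simp_all add: eval_nat_numeral)

lemma jacobsthal_lucas3_eq_jacobsthal3:
  "jacobsthal_lucas3 (n + 3) = 3 * jacobsthal3 (n + 3) + 2 * jacobsthal_lucas3 n"
  by (induction n rule: jacobsthal_lucas3.induct) (simp_all add: eval_nat_numeral)

lemma jacobsthal_lucas3_add_consecutive:
  "jacobsthal_lucas3 (n + 1) + jacobsthal_lucas3 n = 3 * jacobsthal3 (n + 2)"
  by (induction n rule: jacobsthal_lucas3.induct) (simp_all add: eval_nat_numeral)

text \<open>Explicit coordinates reduce linear identities between quaternions to four scalar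
  equations.\<close>

lemma JN3_eq_DQuat:
  "JN3 m = DQuat (jacobsthal3 m) (jacobsthal3 (m + 1)) (jacobsthal3 (m + 2)) (jacobsthal3 (m + 3))"
  by (simp only: JN3_def dquat_expansion)

lemma jN3_eq_DQuat:
  "jN3 m = DQuat (jacobsthal_lucas3 m) (jacobsthal_lucas3 (m + 1))
     (jacobsthal_lucas3 (m + 2)) (jacobsthal_lucas3 (m + 3))"
  by (simp only: jN3_def dquat_expansion)

lemma jN3_eq_JN3: "jN3 (m + 3) = 3 *\<^sub>R JN3 (m + 3) + 2 *\<^sub>R jN3 m"
proof -
  have "real (jacobsthal_lucas3 (n + 3)) = 3 * real (jacobsthal3 (n + 3)) + 2 * real (jacobsthal_lucas3 n)" for n
    unfolding jacobsthal_lucas3_eq_jacobsthal3 by simp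
  from this[of m] this[of "m + 1"] this[of "m + 2"] this[of "m + 3"] show ?thesis
    by (simp add: JN3_eq_DQuat jN3_eq_DQuat plus_dquat_def scaleR_dquat_def add.commute add.left_commute)
qed

lemma jN3_add_consecutive: "jN3 (m + 1) + jN3 m = 3 *\<^sub>R JN3 (m + 2)"
proof -
  have "real (jacobsthal_lucas3 (n + 1)) + real (jacobsthal_lucas3 n) = 3 * real (jacobsthal3 (n + 2))" for n
    using jacobsthal_lucas3_add_consecutive[of n] by linarith
  from this[of m] this[of "m + 1"] this[of "m + 2"] this[of "m + 3"] show ?thesis
    by (simp add: JN3_eq_DQuat jN3_eq_DQuat plus_dquat_def scaleR_dquat_def eval_nat_numeral)
qed

text \<open>The exponent grows by one per coordinate, so factoring out \<open>2 ^ (m + 3)\<close>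
  leaves \<open>1\<close>, \<open>2\<close>, \<open>4\<close>, \<open>8\<close>.\<close>

lemma jN3_add_3: "jN3 (m + 3) = jN3 m + 2 ^ (m + 3) *\<^sub>R DQuat 1 2 4 8"
proof -
  have "real (jacobsthal_lucas3 (n + 3)) = real (jacobsthal_lucas3 n) + 2 ^ (n + 3)" for n
    unfolding jacobsthal_lucas3_add_3 by simp
  from this[of m] this[of "m + 1"] this[of "m + 2"] this[of "m + 3"] show ?thesis
    by (simp add: jN3_eq_DQuat plus_dquat_def scaleR_dquat_def power_add add.commute add.left_commute)
qed

lemma jN3_square_add:
  "(jN3 m)\<^sup>2 + 3 *\<^sub>R (JN3 (m + 3) * jN3 (m + 3)) = 4 ^ (m + 3) *\<^sub>R DQuat 1 4 8 16"
proof -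
  have "3 *\<^sub>R JN3 (m + 3) = jN3 (m + 3) - 2 * jN3 m"
    by (simp add: jN3_eq_JN3 scaleR_2 algebra_simps)
  then have "3 *\<^sub>R (JN3 (m + 3) * jN3 (m + 3)) = (jN3 (m + 3) - 2 * jN3 m) * jN3 (m + 3)"
    by (metis mult_scaleR_left)
  \<comment> \<open>With \<open>a = jN3 m\<close> and \<open>b = jN3 (m + 3)\<close>, commutativity
    gives \<open>a * a + (b - 2 * a) * b = (b - a) * (b - a)\<close>.\<close>
  then have "(jN3 m)\<^sup>2 + 3 *\<^sub>R (JN3 (m + 3) * jN3 (m + 3)) = (jN3 (m + 3) - jN3 m)\<^sup>2"
    by (simp add: power2_eq_square algebra_simps)
  also have "\<dots> = (2 ^ (m + 3) *\<^sub>R DQuat 1 2 4 8)\<^sup>2"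
    by (simp only: jN3_add_3 add_diff_cancel_left')
  \<comment> \<open>Products of imaginary units vanish, so squaring an element with real part
    \<open>1\<close> just doubles its imaginary coordinates.\<close>
  also have "\<dots> = (2 ^ (m + 3))\<^sup>2 *\<^sub>R DQuat 1 4 8 16"
    by (simp add: power2_eq_square times_dquat_def scaleR_dquat_def)
  also have "(2 ^ (m + 3))\<^sup>2 = (4 ^ (m + 3) :: real)"
    by (simp add: power2_eq_square flip: power_mult_distrib)
  finally show ?thesis .
qed

theorem theorem2p2:
  fixes m :: nat
  shows "jN3 (m + 3) - 3 *\<^sub>R JN3 (m + 3) = 2 *\<^sub>R jN3 m
    \<and> jN3 (m + 1) + jN3 m = 3 *\<^sub>R JN3 (m + 2)
    \<and> (jN3 m)\<^sup>2 + 3 *\<^sub>R (JN3 (m + 3) * jN3 (m + 3)) =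
        4 ^ (m + 3) *\<^sub>R (1 + 4 *\<^sub>R dq_i + 8 *\<^sub>R dq_j + 16 *\<^sub>R dq_k)"
proof -
  have "1 + 4 *\<^sub>R dq_i + 8 *\<^sub>R dq_j + 16 *\<^sub>R dq_k = DQuat 1 4 8 16"
    by (simp add: dquat_expansion)
  then show ?thesis
    using jN3_eq_JN3[of m] jN3_add_consecutive[of m] jN3_square_add[of m] by simp
qed

end
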